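(* Let $\mathcal{F}_0$ be the class of all continuous Lebesgue probability densities on $\mathbb{R}$ with a unique local maximum. The mode is not identifiable relative to $\mathcal{F}_0$; that is, there exists no strict $\mathcal{F}_0$-identification function $v\colon\mathbb{R}\times\mathbb{R}\to\mathbb{R}$ for the mode.
   Context: $\mathcal{F}_0$ denotes the class of all continuous functions $f\colon\mathbb{R}\to[0,\infty)$ with $\int_{\mathbb{R}} f(y)\,\mathrm{d}y=1$ that have a unique local maximum (i.e. there is exactly one point of $\mathbb{R}$ at which $f$ attains a local maximum). The mode of a probability density consists of its global maxima; for $f\in\mathcal{F}_0$ it is a singleton and is identified with its unique element, $\mathrm{mode}(f)\in\mathbb{R}$. A strict $\mathcal{F}_0$-identification function for the mode is a measurable function $v\colon\mathbb{R}\times\mathbb{R}\to\mathbb{R}$ such that $\int|v(x,y)f(y)|\,\mathrm{d}y<\infty$ for all $x\in\mathbb{R}$ and all $f\in\mathcal{F}_0$, and $$\int v(x,y)f(y)\,\mathrm{d}y=0\quad\Longleftrightarrow\quad x=\mathrm{mode}(f)$$ for all $x\in\mathbb{R}$ and $f\in\mathcal{F}_0$. The mode is called identifiable relative to $\mathcal{F}_0$ if there exists a strict $\mathcal{F}_0$-identification function for it. *)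

theory Defs
  imports "HOL-Analysis.Analysis"
begin

definition is_local_max :: "(real \<Rightarrow> real) \<Rightarrow> real \<Rightarrow> bool" where
  "is_local_max f x \<longleftrightarrow> (\<forall>\<^sub>F y in nhds x. f y \<le> f x)"

definition F0 :: "(real \<Rightarrow> real) set" where
  "F0 = {f. continuous_on UNIV f \<and> (\<forall>y. 0 \<le> f y) \<and> has_bochner_integral lborel f 1
            \<and> (\<exists>!x. is_local_max f x)}"

definition mode_set :: "(real \<Rightarrow> real) \<Rightarrow> real set" where
  "mode_set f = {x. \<forall>y. f y \<le> f x}"

(* Only meaningful when mode_set f is a singleton; see mode_set_F0 below. *)
definition mode :: "(real \<Rightarrow> real) \<Rightarrow> real" where
  "mode f = the_elem (mode_set f)"

definition strict_identification_function ::
    "(real \<Rightarrow> real) set \<Rightarrow> ((real \<Rightarrow> real) \<Rightarrow> real) \<Rightarrow> (real \<Rightarrow> real \<Rightarrow> real) \<Rightarrow> bool" where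
  "strict_identification_function F T v \<longleftrightarrow>
     (\<lambda>(x, y). v x y) \<in> borel_measurable (borel \<Otimes>\<^sub>M borel) \<and>
     (\<forall>x. \<forall>f\<in>F. integrable lborel (\<lambda>y. v x y * f y)) \<and>
     (\<forall>x. \<forall>f\<in>F. (LINT y|lborel. v x y * f y) = 0 \<longleftrightarrow> x = T f)"

definition identifiable :: "(real \<Rightarrow> real) set \<Rightarrow> ((real \<Rightarrow> real) \<Rightarrow> real) \<Rightarrow> bool" where
  "identifiable F T \<longleftrightarrow> (\<exists>v. strict_identification_function F T v)"

lemma no_interval_lower_bound:
  fixes f :: "real \<Rightarrow> real"
  assumes "has_bochner_integral lborel f 1" "\<And>y. 0 \<le> f y" "0 < c" "b - a = 2 / c"
    and "\<And>z. z \<in> {a..b} \<Longrightarrow> c \<le> f z"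
  shows False
proof -
  have f: "integrable lborel f" "integral\<^sup>L lborel f = 1"
    using assms(1) by (auto simp: has_bochner_integral_iff)
  have "a \<le> b"
    using assms(3,4) by (smt (verit) divide_pos_pos)
  have "(LINT z|lborel. indicator {a..b} z * c) = (b - a) * c"
    using \<open>a \<le> b\<close> by simp
  also have "\<dots> = 2"
    using assms(3,4) by simp
  finally have "(LINT z|lborel. indicator {a..b} z * c) = 2" .
  moreover have "(LINT z|lborel. indicator {a..b} z * c) \<le> integral\<^sup>L lborel f"
  proof (intro integral_mono f(1))
    show "integrable lborel (\<lambda>z. indicator {a..b} z * c)"
      by (intro integrable_mult_left) (simp add: emeasure_lborel_Icc_eq)
    show "indicator {a..b} z * c \<le> f z" for z
      using assms(2,5) by (auto simp: indicator_def)
  qed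
  ultimately show False
    using f(2) by simp
qed

lemma interior_local_max:
  assumes "continuous_on UNIV f" "a < y" "y < b" "f a < f y" "f b < f y"
  obtains w where "a < w" "w < b" "is_local_max f w"
proof -
  have "continuous_on {a..b} f" "{a..b} \<noteq> {}"
    using assms continuous_on_subset by auto
  then obtain w where w: "w \<in> {a..b}" "\<forall>z\<in>{a..b}. f z \<le> f w"
    using continuous_attains_sup[of "{a..b}" f] by auto
  have "f y \<le> f w"
    using w assms by auto
  then have "a < w" "w < b"
    using w(1) assms by (auto simp: less_le)
  moreover have "is_local_max f w"
    unfolding is_local_max_def eventually_nhds
    using w(2) \<open>a < w\<close> \<open>w < b\<close> by (intro exI[of _ "{a<..<b}"]) auto
  ultimately show ?thesis
    using that by blast
qed

lemma mode_set_F0: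
  assumes "f \<in> F0"
  shows "\<exists>m. mode_set f = {m} \<and> is_local_max f m"
proof -
  have f: "continuous_on UNIV f" "\<And>y. 0 \<le> f y" "has_bochner_integral lborel f 1"
    and ex1: "\<exists>!x. is_local_max f x"
    using assms by (auto simp: F0_def)
  obtain m where m: "is_local_max f m" "\<And>x. is_local_max f x \<Longrightarrow> x = m"
    using ex1 by auto
  have "f y \<le> f m" for y
  proof (rule ccontr)
    assume "\<not> f y \<le> f m"
    then have y: "f m < f y" by simp
    then have pos: "0 < f y" using f(2)[of m] by linarith
    then have len: "0 < 2 / f y" by simp
    consider "m < y" | "y < m" using y by fastforce
    then show False
    proof cases
      case 1
      have "f y \<le> f z" if "y \<le> z" for z
        using interior_local_max[OF f(1) 1, of z] y m(2) that
        by (metis less_irrefl linorder_not_less order_le_imp_less_or_eq)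
      then show False
        using no_interval_lower_bound[OF f(3) f(2) pos, of "y + 2 / f y" y] by auto
    next
      case 2
      have "f y \<le> f z" if "z \<le> y" for z
        using interior_local_max[OF f(1) _ 2, of z] y m(2) that
        by (metis less_irrefl linorder_not_less order_le_imp_less_or_eq)
      then show False
        using no_interval_lower_bound[OF f(3) f(2) pos, of y "y - 2 / f y"] by auto
    qed
  qed
  then have "m \<in> mode_set f"
    by (simp add: mode_set_def)
  moreover have "is_local_max f x" if "x \<in> mode_set f" for x
    using that by (simp add: mode_set_def is_local_max_def)
  ultimately show ?thesis
    using m by blast
qed

end

theory Submission
  imports Defs
begin

text \<open>
  For a fixed \<open>x\<close>, the integral of \<open>v x y * f y\<close> is linear in \<open>f\<close>. A strict identification
  function would therefore make the densities with mode \<open>x\<close> the intersection of the class with the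
  kernel of a linear functional. This cannot be, because densities with mode \<open>x\<close> have linear
  combinations with another mode. Take \<open>x = 0\<close>, let \<open>f\<close> be a strictly unimodal Lipschitz
  density with mode \<open>1\<close>, and let \<open>g\<close> be one with mode \<open>0\<close> that has a kink there and
  descends at a rate bounded away from zero on all of \<open>[0, 1]\<close>. Mixing a small multiple
  of \<open>f\<close> into \<open>g\<close> leaves the mode at \<open>0\<close>, as the descent of \<open>g\<close> outweighs the ascent of
  \<open>f\<close> on \<open>[0, 1]\<close> and both are monotone in the same sense elsewhere. The functional then
  vanishes at \<open>g\<close> and at the mixture, hence also at \<open>f\<close>, which has the wrong mode.

  Laplace densities serve as \<open>f\<close> and \<open>g\<close>, with weights \<open>1/4\<close> and \<open>3/4\<close>. Their
  membership in the class and that of the mixture follow from \<open>strictly_unimodal_density\<close>;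
  the one computation is \<open>laplace_mixture_decreasing\<close>.
\<close>

lemma strictly_unimodal_density:
  fixes f :: "real \<Rightarrow> real"
  assumes cont: "continuous_on UNIV f" and nonneg: "\<And>y. 0 \<le> f y"
    and int: "has_bochner_integral lborel f 1"
    and inc: "\<And>s t. s < t \<Longrightarrow> t \<le> m \<Longrightarrow> f s < f t"
    and dec: "\<And>s t. m \<le> s \<Longrightarrow> s < t \<Longrightarrow> f t < f s"
  shows "f \<in> F0" and "mode f = m"
proof -
  have less: "f y < f m" if "y \<noteq> m" for y
    using inc[of y m] dec[of m y] that by (cases "y < m") auto
  then have max: "f y \<le> f m" for y
    by (cases "y = m") (auto intro: less_imp_le)
  have "x = m" if local_max: "is_local_max f x" for x
  proof (rule ccontr)
    assume "x \<noteq> m"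
    obtain d where d: "d > 0" "\<And>y. dist y x < d \<Longrightarrow> f y \<le> f x"
      using local_max by (auto simp: is_local_max_def eventually_nhds_metric)
    \<comment> \<open>A point closer to \<open>m\<close> has a larger value.\<close>
    show False
    proof (cases "x < m")
      case True
      define y where "y = min m (x + d / 2)"
      have "x < y" "y \<le> m" "dist y x < d"
        using True d(1) by (auto simp: y_def dist_real_def)
      then show False
        using inc[of x y] d(2)[of y] by simp
    next
      case False
      define y where "y = max m (x - d / 2)"
      have "y < x" "m \<le> y" "dist y x < d"
        using False \<open>x \<noteq> m\<close> d(1) by (auto simp: y_def dist_real_def)
      then show False
        using dec[of y x] d(2)[of y] by simp
    qed
  qed
  moreover have "is_local_max f m"
    using max by (simp add: is_local_max_def)
  ultimately show "f \<in> F0"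
    using cont nonneg int by (auto simp: F0_def)
  have "mode_set f = {m}"
    using max less by (auto simp: mode_set_def) (meson not_less)
  then show "mode f = m"
    by (simp add: mode_def)
qed

definition laplace_density :: "real \<Rightarrow> real \<Rightarrow> real" where
  "laplace_density m y = exp (- \<bar>y - m\<bar>) / 2"

lemma continuous_on_laplace_density: "continuous_on A (laplace_density m)"
  unfolding laplace_density_def by (intro continuous_intros) auto

lemma laplace_density_nonneg: "0 \<le> laplace_density m y"
  by (simp add: laplace_density_def)

lemma laplace_density_increasing:
  "s < t \<Longrightarrow> t \<le> m \<Longrightarrow> laplace_density m s < laplace_density m t"
  by (simp add: laplace_density_def)

lemma laplace_density_decreasing:
  "m \<le> s \<Longrightarrow> s < t \<Longrightarrow> laplace_density m t < laplace_density m s"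
  by (simp add: laplace_density_def)

lemma has_bochner_integral_laplace_density:
  "has_bochner_integral lborel (laplace_density m) 1"
proof -
  let ?h = "\<lambda>y. indicator {0..} y *\<^sub>R laplace_density 0 y"
  have "((\<lambda>y::real. exp (- y) / 2) has_integral 1/2) {0..}"
    using has_integral_divide[OF has_integral_exp_minus_to_infinity[of 1 0], of 2] by simp
  then have "(laplace_density 0 has_integral 1/2) {0..}"
    by (rule has_integral_eq[rotated]) (simp add: laplace_density_def)
  then have "(\<integral>\<^sup>+ y. ennreal (?h y) \<partial>lborel) = ennreal (1/2)"
    using nn_integral_has_integral_lebesgue[of "{0..}" "laplace_density 0"] laplace_density_nonneg
    by simp
  moreover have "laplace_density 0 \<in> borel_measurable borel"
    by (intro borel_measurable_continuous_onI continuous_on_laplace_density)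
  then have "?h \<in> borel_measurable lborel"
    by simp
  ultimately have "has_bochner_integral lborel ?h (1/2)"
    by (intro has_bochner_integral_nn_integral) (auto simp: laplace_density_nonneg)
  then have "has_bochner_integral lborel (laplace_density 0) (2 *\<^sub>R (1/2))"
    by (rule has_bochner_integral_even_function) (simp add: laplace_density_def)
  then have "has_bochner_integral lborel (\<lambda>y. laplace_density 0 (- m + 1 * y)) 1"
    using lborel_has_bochner_integral_real_affine_iff[of 1 "laplace_density 0" 1 "- m"] by simp
  then show ?thesis
    by (simp add: laplace_density_def[abs_def])
qed

lemma laplace_density_in_F0: "laplace_density m \<in> F0"
  and mode_laplace_density: "mode (laplace_density m) = m"
  using strictly_unimodal_density[OF continuous_on_laplace_density laplace_density_nonneg
      has_bochner_integral_laplace_density laplace_density_increasing laplace_density_decreasing]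
  by auto

definition laplace_mixture :: "real \<Rightarrow> real" where
  "laplace_mixture y = 1/4 * laplace_density 1 y + 3/4 * laplace_density 0 y"

text \<open>
  Beyond \<open>1\<close> both components decrease. Between \<open>0\<close> and \<open>1\<close> the growth of the component at
  \<open>1\<close> is \<open>exp (s + t - 1)\<close> times the loss of the component at \<open>0\<close>, and this factor is below
  \<open>exp 1 \<le> 3\<close>, the ratio of the weights.
\<close>
lemma laplace_mixture_decreasing:
  assumes "0 \<le> s" "s < t"
  shows "laplace_mixture t < laplace_mixture s"
proof -
  have right: "laplace_mixture t < laplace_mixture s" if "1 \<le> s" "s < t" for s t
    using laplace_density_decreasing[of 1 s t] laplace_density_decreasing[of 0 s t] that
    by (simp add: laplace_mixture_def)
  have left: "laplace_mixture t < laplace_mixture s" if "0 \<le> s" "s < t" "t \<le> 1" for s t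
  proof -
    have "exp (s + t - 1) < exp 1"
      using that by simp
    then have "exp (s + t - 1) < 3"
      using exp_le by linarith
    moreover have "0 < exp (- s) - exp (- t)"
      using that by simp
    ultimately have "exp (s + t - 1) * (exp (- s) - exp (- t)) < 3 * (exp (- s) - exp (- t))"
      by (rule mult_strict_right_mono)
    moreover have "exp (s + t - 1) * (exp (- s) - exp (- t)) = exp (t - 1) - exp (s - 1)"
      by (simp add: right_diff_distrib flip: exp_add)
    ultimately show ?thesis
      using that by (simp add: laplace_mixture_def laplace_density_def)
  qed
  show ?thesis
    using left[of s t] right[of s t] left[of s 1] right[of 1 t] assms by linarith
qed

lemma laplace_mixture_in_F0: "laplace_mixture \<in> F0"
  and mode_laplace_mixture: "mode laplace_mixture = 0"
proof -
  have "continuous_on UNIV laplace_mixture"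
    unfolding laplace_mixture_def by (intro continuous_intros continuous_on_laplace_density)
  moreover have "0 \<le> laplace_mixture y" for y
    by (simp add: laplace_mixture_def laplace_density_nonneg)
  moreover have "has_bochner_integral lborel laplace_mixture (1/4 * 1 + 3/4 * 1)"
    unfolding laplace_mixture_def
    by (intro has_bochner_integral_add has_bochner_integral_mult_right
        has_bochner_integral_laplace_density)
  then have "has_bochner_integral lborel laplace_mixture 1"
    by simp
  moreover have "laplace_mixture s < laplace_mixture t" if "s < t" "t \<le> 0" for s t
    using laplace_density_increasing[of s t 1] laplace_density_increasing[of s t 0] that
    by (simp add: laplace_mixture_def)
  ultimately show "laplace_mixture \<in> F0" "mode laplace_mixture = 0"
    using strictly_unimodal_density[of laplace_mixture 0] laplace_mixture_decreasing by blast+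
qed

theorem theorem6:
  shows "\<not> identifiable F0 mode"
proof
  assume "identifiable F0 mode"
  then obtain v where int: "\<And>x f. f \<in> F0 \<Longrightarrow> integrable lborel (\<lambda>y. v x y * f y)"
    and zero: "\<And>x f. f \<in> F0 \<Longrightarrow> (LINT y|lborel. v x y * f y) = 0 \<longleftrightarrow> x = mode f"
    unfolding identifiable_def strict_identification_function_def by blast
  define \<Phi> where "\<Phi> f = (LINT y|lborel. v 0 y * f y)" for f
  have "\<Phi> laplace_mixture
      = (LINT y|lborel. 1/4 * (v 0 y * laplace_density 1 y) + 3/4 * (v 0 y * laplace_density 0 y))"
    unfolding \<Phi>_def by (intro Bochner_Integration.integral_cong)
      (simp_all add: laplace_mixture_def algebra_simps)
  also have "\<dots> = 1/4 * \<Phi> (laplace_density 1) + 3/4 * \<Phi> (laplace_density 0)"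
    unfolding \<Phi>_def using int[OF laplace_density_in_F0, of 0] by simp
  finally have "\<Phi> laplace_mixture = 1/4 * \<Phi> (laplace_density 1) + 3/4 * \<Phi> (laplace_density 0)" .
  moreover have "\<Phi> laplace_mixture = 0" "\<Phi> (laplace_density 0) = 0"
    unfolding \<Phi>_def using zero[of _ 0] laplace_mixture_in_F0 mode_laplace_mixture
      laplace_density_in_F0 mode_laplace_density by simp_all
  moreover have "\<Phi> (laplace_density 1) \<noteq> 0"
    unfolding \<Phi>_def using zero[of _ 0] laplace_density_in_F0 mode_laplace_density by simp
  ultimately show False
    by simp
qed

end
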